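(* Let $F$ be a field with $\mathrm{char}(F)=0$, $(A,+)$ a non-trivial abelian group, $g:A\to F$ a non-zero additive map, $f:A\times A\to F$ an anti-symmetric biadditive non-degenerate map, and $h:A\to F$ an additive map such that $f(a,b)=g(a)h(b)-g(b)h(a)$ for all $a,b\in A$. Let $L=L(A,g,f)$ be the corresponding Block Lie algebra. If $(g(a),h(a))\ne(0,-1)$ for all $a\in A$, then all the transposed Poisson algebra structures on $L(A,g,f)$ are trivial. Otherwise, the transposed Poisson algebra structures on $L(A,g,f)$ are exactly the extensions by zero of commutative associative products $*$ on the complement $V=\mathrm{span}_F\{u_a\mid g(a)=h(a)+2=0\}$ of $[L,L]$ with values in $Z(L)=\mathrm{span}_F\{u_a\mid g(a)=h(a)+1=0\}$.
   Context: All algebras are over $F$ and all linear maps are $F$-linear. Additive maps are homomorphisms of additive groups. Block Lie algebra: $L(A,g,f)$ is the $F$-vector space with basis $\{u_a\}_{a\in A}$ and bilinear product $[u_a,u_b]=(f(a,b)+g(a-b))u_{a+b}$; since $h$ exists it is a Lie algebra. Non-degenerate means: for $a\in A$, $f(a,b)=0$ for all $b\in A$ if and only if $a=0$. A transposed Poisson algebra structure on a Lie algebra $(\mathfrak L,[\cdot,\cdot])$ is a commutative associative bilinear multiplication $\cdot$ on $\mathfrak L$ such that $2z\cdot[x,y]=[z\cdot x,y]+[x,z\cdot y]$ for all $x,y,z\in\mathfrak L$. It is trivial if $x\cdot y=0$ for all $x,y$. $Z(\mathfrak L)$ is the center of $\mathfrak L$ and $[\mathfrak L,\mathfrak L]$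 is the span of all brackets. If $V$ is a vector space complement of $[\mathfrak L,\mathfrak L]$ in $\mathfrak L$ and $*:V\times V\to Z(\mathfrak L)$ is a bilinear commutative product, the extension by zero of $*$ is the product on $\mathfrak L$ given by $(a_1+a_2)\cdot(b_1+b_2)=a_1*b_1$ for $a_1,b_1\in V$, $a_2,b_2\in[\mathfrak L,\mathfrak L]$; $*$ is called associative if this extension by zero is associative. *)

theory Defs
  imports Complex_Main "HOL-Library.Poly_Mapping"
begin

section \<open>Algebras over a field given by a scalar multiplication\<close>

definition bilinear_product ::
  "('k::field \<Rightarrow> 'l::ab_group_add \<Rightarrow> 'l) \<Rightarrow> ('l \<Rightarrow> 'l \<Rightarrow> 'l) \<Rightarrow> bool" where
  "bilinear_product scale m \<longleftrightarrow>
     (\<forall>x. Vector_Spaces.linear scale scale (m x)) \<and>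
     (\<forall>y. Vector_Spaces.linear scale scale (\<lambda>x. m x y))"

definition lie_algebra ::
  "('k::field \<Rightarrow> 'l::ab_group_add \<Rightarrow> 'l) \<Rightarrow> ('l \<Rightarrow> 'l \<Rightarrow> 'l) \<Rightarrow> bool" where
  "lie_algebra scale br \<longleftrightarrow>
     vector_space scale \<and> bilinear_product scale br \<and>
     (\<forall>x. br x x = 0) \<and>
     (\<forall>x y z. br (br x y) z + br (br y z) x + br (br z x) y = 0)"

definition transposed_poisson_structure ::
  "('k::field \<Rightarrow> 'l::ab_group_add \<Rightarrow> 'l) \<Rightarrow> ('l \<Rightarrow> 'l \<Rightarrow> 'l) \<Rightarrow> ('l \<Rightarrow> 'l \<Rightarrow> 'l) \<Rightarrow> bool" where
  "transposed_poisson_structure scale br m \<longleftrightarrow>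
     bilinear_product scale m \<and>
     (\<forall>x y. m x y = m y x) \<and>
     (\<forall>x y z. m (m x y) z = m x (m y z)) \<and>
     (\<forall>x y z. scale 2 (m z (br x y)) = br (m z x) y + br x (m z y))"

definition trivial_product :: "('l::zero \<Rightarrow> 'l \<Rightarrow> 'l) \<Rightarrow> bool" where
  "trivial_product m \<longleftrightarrow> (\<forall>x y. m x y = 0)"

definition lie_center :: "('l::zero \<Rightarrow> 'l \<Rightarrow> 'l) \<Rightarrow> 'l set" where
  "lie_center br = {z. \<forall>x. br z x = 0}"

definition derived_algebra ::
  "('k::field \<Rightarrow> 'l::ab_group_add \<Rightarrow> 'l) \<Rightarrow> ('l \<Rightarrow> 'l \<Rightarrow> 'l) \<Rightarrow> 'l set" where
  "derived_algebra scale br = module.span scale {br x y | x y. True}"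

definition complementary_subspaces ::
  "('k::field \<Rightarrow> 'l::ab_group_add \<Rightarrow> 'l) \<Rightarrow> 'l set \<Rightarrow> 'l set \<Rightarrow> bool" where
  "complementary_subspaces scale V D \<longleftrightarrow>
     module.subspace scale V \<and> module.subspace scale D \<and>
     V \<inter> D = {0} \<and> (\<forall>x. \<exists>v\<in>V. \<exists>d\<in>D. x = v + d)"


section \<open>Extension by zero\<close>

text \<open>Products on a subspace \<open>V\<close> are functions on the ambient type; their values outside
  \<open>V \<times> V\<close> play no role.\<close>

definition bilinear_commutative_on ::
  "('k::field \<Rightarrow> 'l::ab_group_add \<Rightarrow> 'l) \<Rightarrow> 'l set \<Rightarrow> 'l set \<Rightarrow> ('l \<Rightarrow> 'l \<Rightarrow> 'l) \<Rightarrow> bool" where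
  "bilinear_commutative_on scale V Z s \<longleftrightarrow>
     (\<forall>x\<in>V. \<forall>y\<in>V. s x y \<in> Z) \<and>
     (\<forall>x\<in>V. \<forall>y\<in>V. \<forall>z\<in>V. s (x + y) z = s x z + s y z \<and> s z (x + y) = s z x + s z y) \<and>
     (\<forall>c. \<forall>x\<in>V. \<forall>y\<in>V. s (scale c x) y = scale c (s x y) \<and> s x (scale c y) = scale c (s x y)) \<and>
     (\<forall>x\<in>V. \<forall>y\<in>V. s x y = s y x)"

definition component_along :: "'l::ab_group_add set \<Rightarrow> 'l set \<Rightarrow> 'l \<Rightarrow> 'l" where
  "component_along V D x = (THE v. v \<in> V \<and> (\<exists>d\<in>D. x = v + d))"

definition extension_by_zero ::
  "'l::ab_group_add set \<Rightarrow> 'l set \<Rightarrow> ('l \<Rightarrow> 'l \<Rightarrow> 'l) \<Rightarrow> 'l \<Rightarrow> 'l \<Rightarrow> 'l" where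
  "extension_by_zero V D s x y = s (component_along V D x) (component_along V D y)"

definition associative_by_extension ::
  "'l::ab_group_add set \<Rightarrow> 'l set \<Rightarrow> ('l \<Rightarrow> 'l \<Rightarrow> 'l) \<Rightarrow> bool" where
  "associative_by_extension V D s \<longleftrightarrow>
     (\<forall>x y z. extension_by_zero V D s (extension_by_zero V D s x y) z =
              extension_by_zero V D s x (extension_by_zero V D s y z))"

lemma component_along_add:
  assumes vs: "vector_space scale" and "complementary_subspaces scale V D"
    and "a1 \<in> V" "a2 \<in> D"
  shows "component_along V D (a1 + a2) = a1"
  unfolding component_along_def
proof (rule the_equality)
  interpret vector_space scale by (rule vs)
  have V: "subspace V" and D: "subspace D" and VD: "V \<inter> D = {0}"
    using assms(2) by (auto simp: complementary_subspaces_def)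
  show "a1 \<in> V \<and> (\<exists>d\<in>D. a1 + a2 = a1 + d)"
    using assms by blast
  fix v assume "v \<in> V \<and> (\<exists>d\<in>D. a1 + a2 = v + d)"
  then obtain d where v: "v \<in> V" and d: "d \<in> D" "a1 + a2 = v + d" by blast
  have "v - a1 = a2 - d" using d(2) by (simp add: algebra_simps)
  moreover have "v - a1 \<in> V" using V v assms(3) by (rule subspace_diff)
  moreover have "a2 - d \<in> D" using D assms(4) d(1) by (rule subspace_diff)
  ultimately have "v - a1 \<in> V \<inter> D" by simp
  then show "v = a1" using VD by simp
qed

lemma extension_by_zero_add:
  assumes "vector_space scale" "complementary_subspaces scale V D"
    and "a1 \<in> V" "b1 \<in> V" "a2 \<in> D" "b2 \<in> D"
  shows "extension_by_zero V D s (a1 + a2) (b1 + b2) = s a1 b1"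
  using assms by (simp add: extension_by_zero_def component_along_add)


section \<open>Block Lie algebras\<close>

text \<open>The vector space with basis \<open>A\<close> is the type of finitely supported functions on \<open>A\<close>.\<close>

definition block_scale :: "'k::field \<Rightarrow> ('a \<Rightarrow>\<^sub>0 'k) \<Rightarrow> 'a \<Rightarrow>\<^sub>0 'k" where
  "block_scale c x = Poly_Mapping.map ((*) c) x"

definition block_basis :: "'a \<Rightarrow> 'a \<Rightarrow>\<^sub>0 'k::field" where
  "block_basis a = Poly_Mapping.single a 1"

definition block_bracket ::
  "('a::ab_group_add \<Rightarrow> 'k::field) \<Rightarrow> ('a \<Rightarrow> 'a \<Rightarrow> 'k) \<Rightarrow>
   ('a \<Rightarrow>\<^sub>0 'k) \<Rightarrow> ('a \<Rightarrow>\<^sub>0 'k) \<Rightarrow> ('a \<Rightarrow>\<^sub>0 'k)" where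
  "block_bracket g f x y =
     (\<Sum>a\<in>Poly_Mapping.keys x. \<Sum>b\<in>Poly_Mapping.keys y.
        block_scale (Poly_Mapping.lookup x a * Poly_Mapping.lookup y b * (f a b + g (a - b)))
          (block_basis (a + b)))"

definition biadditive :: "('a::ab_group_add \<Rightarrow> 'a \<Rightarrow> 'k::ab_group_add) \<Rightarrow> bool" where
  "biadditive f \<longleftrightarrow> (\<forall>a. additive (f a)) \<and> (\<forall>b. additive (\<lambda>a. f a b))"

definition antisymmetric :: "('a \<Rightarrow> 'a \<Rightarrow> 'k::ab_group_add) \<Rightarrow> bool" where
  "antisymmetric f \<longleftrightarrow> (\<forall>a b. f a b = - f b a)"

definition nondegenerate :: "('a::zero \<Rightarrow> 'a \<Rightarrow> 'k::zero) \<Rightarrow> bool" where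
  "nondegenerate f \<longleftrightarrow> (\<forall>a. (\<forall>b. f a b = 0) \<longleftrightarrow> a = 0)"

lemma lookup_block_scale [simp]:
  "Poly_Mapping.lookup (block_scale c x) a = c * Poly_Mapping.lookup x a"
  by (simp add: block_scale_def map.rep_eq when_def)

lemma vector_space_block_scale:
  "vector_space (block_scale :: 'k::field \<Rightarrow> ('a \<Rightarrow>\<^sub>0 'k) \<Rightarrow> _)"
  by unfold_locales (auto intro!: poly_mapping_eqI simp: lookup_add algebra_simps)

lemma block_scale_basis: "block_scale c (block_basis a) = Poly_Mapping.single a c"
  by (rule poly_mapping_eqI) (simp add: block_basis_def lookup_single when_def)

lemma block_bracket_superset:
  assumes "finite S" "finite T" "Poly_Mapping.keys x \<subseteq> S" "Poly_Mapping.keys y \<subseteq> T"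
  shows "block_bracket g f x y =
     (\<Sum>a\<in>S. \<Sum>b\<in>T.
        Poly_Mapping.single (a + b)
          (Poly_Mapping.lookup x a * Poly_Mapping.lookup y b * (f a b + g (a - b))))"
proof -
  have "block_bracket g f x y = (\<Sum>a\<in>Poly_Mapping.keys x. \<Sum>b\<in>T.
        Poly_Mapping.single (a + b)
          (Poly_Mapping.lookup x a * Poly_Mapping.lookup y b * (f a b + g (a - b))))"
    unfolding block_bracket_def block_scale_basis
    by (intro sum.cong[OF refl] sum.mono_neutral_left assms) (auto simp: in_keys_iff)
  also have "\<dots> = (\<Sum>a\<in>S. \<Sum>b\<in>T.
        Poly_Mapping.single (a + b)
          (Poly_Mapping.lookup x a * Poly_Mapping.lookup y b * (f a b + g (a - b))))"
    by (intro sum.mono_neutral_left assms) (auto simp: in_keys_iff)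
  finally show ?thesis .
qed

lemma block_bracket_basis:
  "block_bracket g f (block_basis a) (block_basis b) =
     block_scale (f a b + g (a - b)) (block_basis (a + b))"
  by (subst block_bracket_superset[of "{a}" "{b}"]) (auto simp: block_basis_def block_scale_basis[unfolded block_basis_def])

lemma block_bracket_add_left:
  "block_bracket g f (x + x') y = block_bracket g f x y + block_bracket g f x' y"
proof -
  let ?S = "Poly_Mapping.keys x \<union> Poly_Mapping.keys x'"
  let ?T = "Poly_Mapping.keys y"
  have k: "Poly_Mapping.keys (x + x') \<subseteq> ?S" by (rule keys_add)
  show ?thesis
    by (subst (1 2 3) block_bracket_superset[of ?S ?T])
       (use k in \<open>auto simp: lookup_add algebra_simps single_add sum.distrib\<close>)
qed

lemma block_bracket_add_right:
  "block_bracket g f x (y + y') = block_bracket g f x y + block_bracket g f x y'"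
proof -
  let ?S = "Poly_Mapping.keys y \<union> Poly_Mapping.keys y'"
  let ?T = "Poly_Mapping.keys x"
  have k: "Poly_Mapping.keys (y + y') \<subseteq> ?S" by (rule keys_add)
  show ?thesis
    by (subst (1 2 3) block_bracket_superset[of ?T ?S])
       (use k in \<open>auto simp: lookup_add algebra_simps single_add sum.distrib\<close>)
qed

lemma block_scale_single:
  "block_scale c (Poly_Mapping.single a d) = Poly_Mapping.single a (c * d)"
  by (rule poly_mapping_eqI) (simp add: lookup_single when_def)

lemma block_scale_sum: "block_scale c (sum X S) = (\<Sum>i\<in>S. block_scale c (X i))"
  by (rule poly_mapping_eqI) (simp add: lookup_sum sum_distrib_left)

lemma keys_block_scale: "Poly_Mapping.keys (block_scale c x) \<subseteq> Poly_Mapping.keys x"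
  by (auto simp: in_keys_iff)

lemma block_bracket_scale_left:
  "block_bracket g f (block_scale c x) y = block_scale c (block_bracket g f x y)"
  by (subst (1 2) block_bracket_superset[of "Poly_Mapping.keys x" "Poly_Mapping.keys y"])
     (use keys_block_scale[of c x] in \<open>auto simp: block_scale_sum block_scale_single mult_ac\<close>)

lemma block_bracket_scale_right:
  "block_bracket g f x (block_scale c y) = block_scale c (block_bracket g f x y)"
  by (subst (1 2) block_bracket_superset[of "Poly_Mapping.keys x" "Poly_Mapping.keys y"])
     (use keys_block_scale[of c y] in \<open>auto simp: block_scale_sum block_scale_single mult_ac\<close>)

lemma bilinear_product_block_bracket: "bilinear_product block_scale (block_bracket g f)"
proof -
  note vs = vector_space_block_scale
  show ?thesis
    unfolding bilinear_product_def
    by (auto intro!: Vector_Spaces.linear.intro module_hom.intro module_hom_axioms.intro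
        vs vs[unfolded module_iff_vector_space[symmetric]]
        simp: block_bracket_add_left block_bracket_add_right
          block_bracket_scale_left block_bracket_scale_right)
qed

lemma block_single_induct:
  fixes x :: "'a \<Rightarrow>\<^sub>0 'k::field"
  assumes "\<And>a c. P (Poly_Mapping.single a c)" and "\<And>x y. P x \<Longrightarrow> P y \<Longrightarrow> P (x + y)"
  shows "P x"
proof -
  have P0: "P 0" using assms(1)[of undefined 0] by simp
  have "P (\<Sum>a\<in>S. Poly_Mapping.single a (Poly_Mapping.lookup x a))" if "finite S" for S
    using that by (induction S) (auto intro: assms P0)
  moreover have "(\<Sum>a\<in>Poly_Mapping.keys x. Poly_Mapping.single a (Poly_Mapping.lookup x a)) = x"
    by (rule poly_mapping_eqI) (simp add: lookup_sum lookup_single when_def in_keys_iff)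
  ultimately show ?thesis by (metis finite_keys)
qed

lemma block_bracket_single:
  "block_bracket g f (Poly_Mapping.single a c) (Poly_Mapping.single b d) =
     Poly_Mapping.single (a + b) (c * d * (f a b + g (a - b)))"
  by (subst block_bracket_superset[of "{a}" "{b}"]) auto

theorem lie_algebra_block:
  fixes g h :: "'a::ab_group_add \<Rightarrow> 'k::field_char_0"
  assumes g: "additive g" and h: "additive h"
    and f: "\<And>a b. f a b = g a * h b - g b * h a"
  shows "lie_algebra block_scale (block_bracket g f)"
proof -
  let ?br = "block_bracket g f"
  note [simp] = block_bracket_add_left block_bracket_add_right
  have gd: "g (a - b) = g a - g b" for a b using additive.diff[OF g] .
  have ga: "g (a + b) = g a + g b" for a b using additive.add[OF g] .
  have ha: "h (a + b) = h a + h b" for a b using additive.add[OF h] .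
  have anti: "?br x y + ?br y x = 0" for x y
  proof (induction x rule: block_single_induct)
    case (1 a c)
    show ?case
    proof (induction y rule: block_single_induct)
      case (1 b d)
      have "c * d * (f a b + g (a - b)) + d * c * (f b a + g (b - a)) = 0"
        by (simp add: f gd algebra_simps)
      then show ?case
        by (simp add: block_bracket_single add.commute[of b a] flip: single_add)
    next
      case (2 y z)
      have "?br (Poly_Mapping.single a c) (y + z) + ?br (y + z) (Poly_Mapping.single a c) =
        (?br (Poly_Mapping.single a c) y + ?br y (Poly_Mapping.single a c)) +
        (?br (Poly_Mapping.single a c) z + ?br z (Poly_Mapping.single a c))" by simp
      then show ?case using 2 by simp
    qed
  next
    case (2 x z)
    have "?br (x + z) y + ?br y (x + z) = (?br x y + ?br y x) + (?br z y + ?br y z)" by simp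
    then show ?case using 2 by simp
  qed
  have alt: "?br x x = 0" for x
  proof (rule poly_mapping_eqI)
    fix a
    have "Poly_Mapping.lookup (?br x x) a + Poly_Mapping.lookup (?br x x) a = 0"
      using anti[of x x] by (metis lookup_add lookup_zero)
    then show "Poly_Mapping.lookup (?br x x) a = Poly_Mapping.lookup 0 a"
      by (simp flip: mult_2)
  qed
  define J where "J x y z = ?br (?br x y) z + ?br (?br y z) x + ?br (?br z x) y" for x y z
  have J1: "J (x + x') y z = J x y z + J x' y z" for x x' y z by (simp add: J_def)
  have J2: "J x (y + y') z = J x y z + J x y' z" for x y y' z by (simp add: J_def)
  have J3: "J x y (z + z') = J x y z + J x y z'" for x y z z' by (simp add: J_def)
  have J0: "J (Poly_Mapping.single a p) (Poly_Mapping.single b q) (Poly_Mapping.single c r) = 0"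
    for a b c p q r
  proof -
    have e: "b + c + a = a + b + c" "c + a + b = a + b + c" by (simp_all add: ac_simps)
    have "p * q * (f a b + g (a - b)) * r * (f (a + b) c + g (a + b - c)) +
       q * r * (f b c + g (b - c)) * p * (f (b + c) a + g (b + c - a)) +
       r * p * (f c a + g (c - a)) * q * (f (c + a) b + g (c + a - b)) = 0"
      unfolding f gd ga ha by algebra
    then show ?thesis
      unfolding J_def by (simp add: block_bracket_single e flip: single_add)
  qed
  have "J x y z = 0" for x y z
  proof (induction x rule: block_single_induct)
    case x: (1 a p)
    show ?case
    proof (induction y rule: block_single_induct)
      case y: (1 b q)
      show ?case by (induction z rule: block_single_induct) (simp_all add: J0 J3)
    qed (simp add: J2)
  qed (simp add: J1)
  then show ?thesis
    unfolding lie_algebra_def J_def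
    using vector_space_block_scale bilinear_product_block_bracket alt by blast
qed

end

theory Submission
  imports Defs
begin

text \<open>
  Multiplication by a fixed element in a transposed Poisson algebra is a 1/2-derivation. A
  1/2-derivation splits into homogeneous components of degree \<open>d \<in> A\<close>, each given by a scalar
  function \<open>p\<close> on \<open>A\<close>. Comparing with the bracket by \<open>u\<^sub>0\<close>, which acts diagonally with eigenvalues
  \<open>g\<close>, expresses \<open>p\<close> by \<open>p 0\<close> off the set \<open>g = g d\<close>, and the remaining identities show that \<open>p\<close>
  vanishes for \<open>d \<noteq> 0\<close>, except possibly when it sends the one basis vector outside the derived
  algebra to the center, while \<open>p\<close> is constant for \<open>d = 0\<close>. Commutativity of the product then kills
  the scalar components as well.
\<close>

interpretation block: vector_space "block_scale :: 'k::field \<Rightarrow> ('a \<Rightarrow>\<^sub>0 'k) \<Rightarrow> _"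
  by (rule vector_space_block_scale)

section \<open>Coordinates with respect to the basis of the u_a\<close>

lemma lookup_block_basis:
  "Poly_Mapping.lookup (block_basis a) b = (if b = a then 1 else 0)"
  by (simp add: block_basis_def lookup_single when_def)

text \<open>Turns membership in the center, the derived algebra and its complement into vanishing
  conditions on coordinates.\<close>

lemma span_block_basis:
  fixes P :: "'a \<Rightarrow> bool"
  shows "block.span {block_basis a :: 'a \<Rightarrow>\<^sub>0 'k::field | a. P a} =
    {x. \<forall>a. \<not> P a \<longrightarrow> Poly_Mapping.lookup x a = 0}" (is "block.span ?B = ?R")
proof
  have "block.subspace ?R"
    by (auto simp: block.subspace_def lookup_add)
  moreover have "?B \<subseteq> ?R" by (auto simp: lookup_block_basis)
  ultimately show "block.span ?B \<subseteq> ?R" by (rule block.span_minimal[rotated])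
next
  show "?R \<subseteq> block.span ?B"
  proof
    fix x :: "'a \<Rightarrow>\<^sub>0 'k" assume x: "x \<in> ?R"
    have "x = (\<Sum>a\<in>Poly_Mapping.keys x.
        block_scale (Poly_Mapping.lookup x a) (block_basis a))"
      by (rule poly_mapping_eqI)
        (simp add: block_scale_basis lookup_sum lookup_single when_def in_keys_iff)
    also have "\<dots> \<in> block.span ?B"
      using x by (intro block.span_sum block.span_scale block.span_base) (auto simp: in_keys_iff)
    finally show "x \<in> block.span ?B" .
  qed
qed

lemma block_basis_induct:
  fixes x :: "'a \<Rightarrow>\<^sub>0 'k::field"
  assumes "\<And>a. P (block_basis a)" and "\<And>c x. P x \<Longrightarrow> P (block_scale c x)"
    and "\<And>x y. P x \<Longrightarrow> P y \<Longrightarrow> P (x + y)"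
  shows "P x"
  by (induction x rule: block_single_induct) (metis assms(1,2) block_scale_basis, rule assms(3))

lemma bilinear_product_iff:
  fixes m :: "('a \<Rightarrow>\<^sub>0 'k::field) \<Rightarrow> ('a \<Rightarrow>\<^sub>0 'k) \<Rightarrow> ('a \<Rightarrow>\<^sub>0 'k)"
  shows "bilinear_product block_scale m \<longleftrightarrow>
    (\<forall>x y z. m x (y + z) = m x y + m x z) \<and> (\<forall>x y z. m (x + y) z = m x z + m y z) \<and>
    (\<forall>c x y. m x (block_scale c y) = block_scale c (m x y)) \<and>
    (\<forall>c x y. m (block_scale c x) y = block_scale c (m x y))"
  unfolding bilinear_product_def Vector_Spaces.linear_def module_hom_def module_hom_axioms_def
    module_iff_vector_space
  by (auto simp: vector_space_block_scale)


section \<open>The structure constants\<close>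

locale block_lie =
  fixes g h :: "'a::ab_group_add \<Rightarrow> 'k::field_char_0"
    and f :: "'a \<Rightarrow> 'a \<Rightarrow> 'k"
  assumes g_additive: "additive g"
    and g_nonzero: "\<exists>a. g a \<noteq> 0"
    and f_nondeg: "nondegenerate f"
    and h_additive: "additive h"
    and f_gh: "f a b = g a * h b - g b * h a"
begin

text \<open>The determinant of the vectors \<open>(g a, h a + 1)\<close> and
  \<open>(g b, h b + 1)\<close>. Degrees with vector \<open>(0, 0)\<close> give the central basis
  elements.\<close>

definition bk :: "'a \<Rightarrow> 'a \<Rightarrow> 'k" where
  "bk a b = g a * (h b + 1) - g b * (h a + 1)"

abbreviation br :: "('a \<Rightarrow>\<^sub>0 'k) \<Rightarrow> ('a \<Rightarrow>\<^sub>0 'k) \<Rightarrow> ('a \<Rightarrow>\<^sub>0 'k)" where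
  "br \<equiv> block_bracket g f"

lemma additive_simps:
  "g (a + b) = g a + g b" "g (a - b) = g a - g b" "g (- a) = - g a" "g 0 = 0"
  "h (a + b) = h a + h b" "h (a - b) = h a - h b" "h (- a) = - h a" "h 0 = 0"
  using g_additive h_additive
  by (simp_all add: additive.add additive.diff additive.minus additive.zero)

lemma structure_constant: "f a b + g (a - b) = bk a b"
  by (simp add: f_gh bk_def additive_simps algebra_simps)

text \<open>As \<open>f\<close> is built from \<open>g\<close> and \<open>h\<close>, a difference on
  which both vanish lies in the radical of \<open>f\<close>. Hence at most one u_a is central, and
  at most one lies outside the derived algebra.\<close>

lemma gh_inject:
  assumes "g a = g b" "h a = h b"
  shows "a = b"
proof -
  have "f (a - b) c = 0" for c by (simp add: f_gh additive_simps assms)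
  then have "a - b = 0" using f_nondeg unfolding nondegenerate_def by blast
  then show ?thesis by simp
qed

lemma br_basis: "br (block_basis a) (block_basis b) = block_scale (bk a b) (block_basis (a + b))"
  by (simp add: block_bracket_basis structure_constant)

text \<open>Bracketing with u_b shifts degrees by \<open>b\<close> without mixing them, so each
  coordinate of the bracket comes from a single coordinate of \<open>x\<close>. This allows
  homogeneous components to be separated.\<close>

lemma lookup_br_basis_right:
  "Poly_Mapping.lookup (br x (block_basis b)) (c + b) = Poly_Mapping.lookup x c * bk c b"
proof (induction x rule: block_basis_induct)
  case (1 a)
  then show ?case by (simp add: br_basis lookup_block_basis)
next
  case (2 k x)
  then show ?case by (simp add: block_bracket_scale_left)
next
  case (3 x y)
  then show ?case by (simp add: block_bracket_add_left lookup_add algebra_simps)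
qed

lemma br_swap: "br x y = - br y x"
proof -
  have alt: "br x x = 0" for x
    using lie_algebra_block[OF g_additive h_additive f_gh] unfolding lie_algebra_def by blast
  have "br (x + y) (x + y) = 0" by (rule alt)
  then have "br x y + br y x = 0"
    by (simp add: block_bracket_add_left block_bracket_add_right alt add.commute)
  then show ?thesis by (rule eq_neg_iff_add_eq_0[THEN iffD2])
qed

lemma lookup_br_basis_left:
  "Poly_Mapping.lookup (br (block_basis b) x) (b + c) = Poly_Mapping.lookup x c * bk b c"
  using lookup_br_basis_right[of x b c]
  by (subst br_swap) (simp add: add.commute[of b c] bk_def right_diff_distrib)

section \<open>Center and derived algebra\<close>

lemma lie_center_eq: "lie_center br = block.span {block_basis a | a. g a = 0 \<and> h a + 1 = 0}"
proof -
  have "(\<forall>x. br z x = 0) \<longleftrightarrow>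
    (\<forall>a. \<not> (g a = 0 \<and> h a + 1 = 0) \<longrightarrow> Poly_Mapping.lookup z a = 0)" (is "?l \<longleftrightarrow> ?r") for z
  proof
    assume l: ?l
    show ?r
    proof (intro allI impI)
      fix a assume a: "\<not> (g a = 0 \<and> h a + 1 = 0)"
      obtain b where b: "g b \<noteq> 0" using g_nonzero by blast
      have z: "Poly_Mapping.lookup z a * bk a c = 0" for c
        using lookup_br_basis_right[of z c a] l by simp
      \<comment> \<open>\<open>bk a 0 = g a\<close> settles \<open>g a \<noteq> 0\<close>; otherwise
        \<open>bk a b = - g b * (h a + 1)\<close> is non-zero.\<close>
      show "Poly_Mapping.lookup z a = 0"
        using z[of 0] z[of b] a b by (auto simp: bk_def additive_simps)
    qed
  next
    assume r: ?r
    have "br z (block_basis b) = 0" for b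
    proof (rule poly_mapping_eqI)
      fix c
      have "Poly_Mapping.lookup z (c - b) * bk (c - b) b = 0"
        using r by (cases "g (c - b) = 0 \<and> h (c - b) + 1 = 0") (auto simp: bk_def)
      then show "Poly_Mapping.lookup (br z (block_basis b)) c = Poly_Mapping.lookup 0 c"
        using lookup_br_basis_right[of z b "c - b"] by simp
    qed
    then have "br z x = 0" for x
      by (induction x rule: block_basis_induct)
        (auto simp: block_bracket_scale_right block_bracket_add_right)
    then show ?l by blast
  qed
  then show ?thesis unfolding span_block_basis lie_center_def by blast
qed

text \<open>Structure constants of the brackets landing in a fixed degree \<open>c\<close>. They
  vanish for all \<open>b\<close> exactly if \<open>g c = 0\<close> and \<open>h c = -2\<close>,
  which is where the constant 2 in the complement comes from.\<close>

lemma bk_diff: "bk b (c - b) = g b * (h c + 2) - g c * (h b + 1)"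
  by (simp add: bk_def additive_simps algebra_simps)

lemma derived_algebra_eq:
  "derived_algebra block_scale br =
    block.span {block_basis a | a. \<not> (g a = 0 \<and> h a + 2 = 0)}" (is "_ = block.span ?B")
  unfolding derived_algebra_def
proof (rule block.span_eq[THEN iffD2], intro conjI subsetI)
  fix z assume "z \<in> {br x y | x y. True}"
  then obtain x y where z: "z = br x y" by blast
  have "br (block_basis a) (block_basis b) \<in> block.span ?B" for a b
  proof (cases "g (a + b) = 0 \<and> h (a + b) + 2 = 0")
    case True
    then have "bk a b = 0" using bk_diff[of a "a + b"] by (simp add: add.commute)
    then show ?thesis by (simp add: br_basis block.span_zero)
  next
    case False
    then show ?thesis unfolding br_basis
      by (intro block.span_scale block.span_base) blast
  qed
  then have "br (block_basis a) y \<in> block.span ?B" for a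
    by (induction y rule: block_basis_induct)
      (auto simp: block_bracket_scale_right block_bracket_add_right
        intro: block.span_add block.span_scale)
  then have "br x y \<in> block.span ?B"
    by (induction x rule: block_basis_induct)
      (auto simp: block_bracket_scale_left block_bracket_add_left
        intro: block.span_add block.span_scale)
  then show "z \<in> block.span ?B" using z by simp
next
  fix z assume "z \<in> ?B"
  then obtain c where z: "z = block_basis c" and c: "\<not> (g c = 0 \<and> h c + 2 = 0)" by blast
  obtain b' where b': "g b' \<noteq> 0" using g_nonzero by blast
  \<comment> \<open>Some bracket hits u_c: any \<open>b\<close> with \<open>g b \<noteq> 0\<close>
    works if \<open>g c = 0\<close>, and \<open>b = 0\<close> works otherwise.\<close>
  have "\<exists>b. bk b (c - b) \<noteq> 0"
  proof (cases "g c = 0")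
    case True
    then show ?thesis using b' c by (intro exI[of _ b']) (simp add: bk_diff)
  next
    case False
    then have "bk 0 (c - 0) \<noteq> 0" by (subst bk_diff) (simp add: additive_simps)
    then show ?thesis by blast
  qed
  then obtain b where b: "bk b (c - b) \<noteq> 0" by blast
  have "block_scale (inverse (bk b (c - b))) (br (block_basis b) (block_basis (c - b))) = z"
    using b by (simp add: br_basis z)
  then show "z \<in> block.span {br x y | x y. True}"
    using block.span_scale[OF block.span_base] by (metis (mono_tags, lifting) mem_Collect_eq)
qed


section \<open>Homogeneous 1/2-derivations\<close>

text \<open>In characteristic 0 the values \<open>g b + n * g d\<close> are pairwise distinct, so
  some translate of \<open>b\<close> by a multiple of \<open>d\<close> avoids \<open>S\<close>. Such
  translations preserve \<open>f b d\<close>.\<close>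

lemma ex_g_avoiding:
  assumes "finite S" "g d \<noteq> 0"
  shows "\<exists>c n. g c = g b + of_nat n * g d \<and> h c = h b + of_nat n * h d \<and> g c \<notin> S"
proof -
  have it: "g (((+) d ^^ n) b) = g b + of_nat n * g d \<and>
      h (((+) d ^^ n) b) = h b + of_nat n * h d" for n
    by (induction n) (auto simp: additive_simps algebra_simps)
  have "inj (\<lambda>n. g b + of_nat n * g d)" using assms(2) by (auto intro!: injI)
  then have "\<not> range (\<lambda>n. g b + of_nat n * g d) \<subseteq> S"
    using assms(1) by (metis finite_subset finite_imageD infinite_UNIV_nat)
  then obtain n where "g b + of_nat n * g d \<notin> S" by blast
  then show ?thesis using it[of n] by metis
qed

text \<open>The assumption is the coefficient form of the 1/2-derivation identity for the map of
  degree \<open>d\<close> sending u_a to \<open>p a\<close> times u_{a+d}.\<close>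

context
  fixes p :: "'a \<Rightarrow> 'k" and d :: 'a
  assumes half: "2 * bk a b * p (a + b) = bk (a + d) b * p a + bk a (b + d) * p b"
begin

text \<open>Put \<open>b = 0\<close> and use \<open>bk x 0 = g x\<close>. This determines
  \<open>p a\<close> from \<open>p 0\<close> whenever \<open>g a \<noteq> g d\<close>.\<close>

lemma half_by_zero: "(g a - g d) * p a = bk a d * p 0"
  using half[of a 0] by (simp add: bk_def additive_simps algebra_simps)

lemma half_degree_zero:
  assumes "d = 0"
  shows "p a = p 0"
proof -
  have g: "p a = p 0" if "g a \<noteq> 0" for a
    using half_by_zero[of a] that by (simp add: assms bk_def additive_simps)
  show ?thesis
  proof (cases "g a = 0")
    case True
    obtain b where b: "g b \<noteq> 0" using g_nonzero by blast
    show ?thesis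
    proof (cases "h a + 1 = 0")
      case ha: True
      \<comment> \<open>Here u_a is central, so brackets with it carry no information. Producing it
        as a multiple of the bracket of u_b and u_{a-b} does, since
        \<open>h a + 2 = 1\<close>.\<close>
      have "2 * (g b * (h a + 2) * (p a - p 0)) = 0"
        using half[of b "a - b"] g[of b] g[of "a - b"] b True
        by (simp add: assms bk_diff additive_simps algebra_simps)
      moreover have "h a = -1" using ha by (simp add: eq_neg_iff_add_eq_0)
      ultimately show ?thesis using b by simp
    next
      case ha: False
      have "g b * (h a + 1) * (p a - p 0) = 0"
        using half[of a b] g[of b] g[of "a + b"] b True
        by (simp add: assms bk_def additive_simps algebra_simps)
      then show ?thesis using ha b by simp
    qed
  qed (rule g)
qed

text \<open>Once \<open>p\<close> vanishes off \<open>g = 0\<close>, a degree \<open>a\<close> with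
  \<open>g a = 0\<close> obeys two constraints: u_a as a target of brackets gives
  \<open>(h a + 2) * p a = 0\<close>, and u_a as a factor gives
  \<open>(h a + 1 + h d) * p a = 0\<close>. Both are void only if \<open>h a = -2\<close> and
  \<open>h d = 1\<close>, when u_a is outside the derived algebra and u_{a+d} is central.\<close>

lemma half_degree_horizontal:
  assumes gd: "g d = 0" and d: "d \<noteq> 0"
    and a: "\<not> (g a = 0 \<and> h a = -2 \<and> h d = 1)"
  shows "p a = 0"
proof -
  obtain b where b: "g b \<noteq> 0" using g_nonzero by blast
  have hd: "h d \<noteq> 0" using gh_inject[of d 0] gd d by (auto simp: additive_simps)
  have p: "p a = (h d + 1) * p 0" if "g a \<noteq> 0" for a
    using half_by_zero[of a] that by (simp add: gd bk_def)
  \<comment> \<open>\<open>g\<close> is non-zero at \<open>b\<close>, \<open>2b\<close> and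
    \<open>3b\<close>, so \<open>p\<close> takes the same value there; the two sides of the identity
    then differ by a multiple of \<open>h d\<close>.\<close>
  have "g b * h d * ((h d + 1) * p 0) = 0"
    using half[of b "b + b"] p[of b] p[of "b + b"] p[of "b + (b + b)"] b
    by (simp add: bk_def additive_simps gd algebra_simps)
  then have p0: "p a = 0" if "g a \<noteq> 0" for a using p[OF that] b hd by simp
  show ?thesis
  proof (cases "g a = 0")
    case ga: True
    have 1: "g b * (h a + 2) * p a = 0"
      using half[of b "a - b"] p0[of b] p0[of "a - b"] b ga
      by (simp add: bk_diff additive_simps)
    have 2: "g b * (h a + 1 + h d) * p a = 0"
      using half[of a b] p0[of b] p0[of "a + b"] b ga gd
      by (simp add: bk_def additive_simps algebra_simps)
    show ?thesis
    proof (cases "h a = -2")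
      case True
      then show ?thesis using 2 a ga b by auto
    next
      case False
      then show ?thesis using 1 b by (auto simp: eq_neg_iff_add_eq_0)
    qed
  qed (rule p0)
qed

lemma half_degree_general:
  assumes gd: "g d \<noteq> 0"
  shows "p a = 0"
proof -
  have p0: "p 0 = 0"
  proof (rule ccontr)
    assume nz: "p 0 \<noteq> 0"
    text \<open>The identity for \<open>(a, -a)\<close> factors into two linear conditions on \<open>a\<close>; elements
      \<open>b + n d\<close> with \<open>f b d \<noteq> 0\<close> and \<open>n\<close> large violate both.\<close>
    have two: "f a d = 0 \<or> f a d = - 3 * g a"
      if "g a \<noteq> 0" "g a \<noteq> g d" "g a \<noteq> - g d" for a
    proof -
      define G H \<gamma> \<delta> where "G = g a" and "H = h a" and "\<gamma> = g d" and "\<delta> = h d"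
      note defs = G_def[symmetric] H_def[symmetric] \<gamma>_def[symmetric] \<delta>_def[symmetric]
      have e1: "(G - \<gamma>) * p a = (G * (\<delta> + 1) - \<gamma> * (H + 1)) * p 0"
        using half_by_zero[of a] by (simp add: bk_def defs)
      have e2: "(- G - \<gamma>) * p (- a) = (- G * (\<delta> + 1) - \<gamma> * (- H + 1)) * p 0"
        using half_by_zero[of "- a"] by (simp add: bk_def additive_simps defs)
      have e3: "4 * G * p 0 = ((G + \<gamma>) * (- H + 1) + G * (H + \<delta> + 1)) * p a +
          (G * (- H + \<delta> + 1) - (- G + \<gamma>) * (H + 1)) * p (- a)"
        using half[of a "- a"] by (simp add: bk_def additive_simps defs algebra_simps)
      \<comment> \<open>Elimination of \<open>p a\<close> and \<open>p (- a)\<close> from the three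
        linear relations; \<open>G * \<delta> - \<gamma> * H\<close> is
        \<open>f a d\<close>.\<close>
      have "2 * G * (G * \<delta> - \<gamma> * H) * (G * \<delta> - \<gamma> * H + 3 * G) * p 0 = 0"
        using e1 e2 e3 by algebra
      then have "G * \<delta> - \<gamma> * H = 0 \<or> G * \<delta> - \<gamma> * H + 3 * G = 0"
        using nz that(1) by (simp only: mult_eq_0_iff G_def) simp
      then show ?thesis
        by (simp add: f_gh G_def H_def \<gamma>_def \<delta>_def eq_neg_iff_add_eq_0)
    qed
    have "d \<noteq> 0" using gd by (auto simp: additive_simps)
    then obtain b where "f d b \<noteq> 0" using f_nondeg unfolding nondegenerate_def by blast
    then have b: "f b d \<noteq> 0" by (auto simp: f_gh algebra_simps)
    \<comment> \<open>The first three values are those excluded in \<open>two\<close>. The fourth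
      rules out \<open>f c d = - 3 * g c\<close>, because \<open>f c d = f b d\<close>.\<close>
    obtain c n where c: "g c = g b + of_nat n * g d" "h c = h b + of_nat n * h d"
        "g c \<notin> {0, g d, - g d, - f b d / 3}"
      using ex_g_avoiding[of "{0, g d, - g d, - f b d / 3}" d b] gd by blast
    have "f c d = f b d" by (simp add: f_gh c algebra_simps)
    then show False using two[of c] b c(3) by auto
  qed
  then have off: "p a = 0" if "g a \<noteq> g d" for a using half_by_zero[of a] that by simp
  show ?thesis
  proof (cases "g a = g d")
    case True
    \<comment> \<open>Write \<open>a = (a + a) + (- a)\<close>: on the summands \<open>g\<close>
      equals \<open>2 * g d\<close> and \<open>- g d\<close>, both different from
      \<open>g d\<close>, so \<open>off\<close> applies.\<close>
    have "p (a + a) = 0" "p (- a) = 0"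
      using True gd by (auto intro!: off simp: additive_simps)
    moreover have "bk (a + a) (- a) = 3 * g a"
      by (simp add: bk_def additive_simps algebra_simps)
    ultimately show ?thesis using half[of "a + a" "- a"] True gd by simp
  qed (rule off)
qed

end


section \<open>Transposed Poisson products\<close>

text \<open>The bracket respects the grading, so the component of \<open>\<phi>\<close> of degree
  \<open>c - a\<close> satisfies the identity by itself and the three cases on the degree apply. The
  excluded pairs are those with u_a outside the derived algebra and u_c central.\<close>

lemma half_derivation_lookup:
  assumes add: "\<And>x y. \<phi> (x + y) = \<phi> x + \<phi> y"
    and scale: "\<And>c x. \<phi> (block_scale c x) = block_scale c (\<phi> x)"
    and half: "\<And>x y. block_scale 2 (\<phi> (br x y)) = br (\<phi> x) y + br x (\<phi> y)"
    and ac: "\<not> (g a = 0 \<and> h a + 2 = 0 \<and> g c = 0 \<and> h c + 1 = 0)"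
  shows "Poly_Mapping.lookup (\<phi> (block_basis a)) c =
    (if c = a then Poly_Mapping.lookup (\<phi> (block_basis 0)) 0 else 0)"
proof -
  define d where "d = c - a"
  define p where "p a = Poly_Mapping.lookup (\<phi> (block_basis a)) (a + d)" for a
  have c: "c = a + d" by (simp add: d_def)
  have H: "2 * bk a b * p (a + b) = bk (a + d) b * p a + bk a (b + d) * p b" for a b
  proof -
    have "2 * (bk a b * p (a + b)) =
        Poly_Mapping.lookup (br (\<phi> (block_basis a)) (block_basis b)) (a + d + b) +
        Poly_Mapping.lookup (br (block_basis a) (\<phi> (block_basis b))) (a + (b + d))"
      using arg_cong[OF half[of "block_basis a" "block_basis b"],
          of "\<lambda>x. Poly_Mapping.lookup x (a + b + d)"]
      by (simp add: br_basis scale lookup_add p_def ac_simps)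
    then show ?thesis
      unfolding lookup_br_basis_left lookup_br_basis_right by (simp add: p_def ac_simps)
  qed
  show ?thesis
  proof (cases "d = 0")
    case True
    then show ?thesis using half_degree_zero[of p d, OF H] by (simp add: c p_def)
  next
    case False
    have "p a = 0"
    proof (cases "g d = 0")
      case True
      then show ?thesis
        using ac False by (intro half_degree_horizontal[of p d, OF H]) (auto simp: c additive_simps)
    qed (rule half_degree_general[of p d, OF H])
    then show ?thesis using False by (simp add: c p_def)
  qed
qed

context
  fixes m
  assumes tp: "transposed_poisson_structure block_scale br m"
begin

lemma tp_simps:
  "m x (y + z) = m x y + m x z" "m (x + y) z = m x z + m y z"
  "m x (block_scale c y) = block_scale c (m x y)" "m (block_scale c x) y = block_scale c (m x y)"
  "m x y = m y x" "m (m x y) z = m x (m y z)"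
  "block_scale 2 (m z (br x y)) = br (m z x) y + br x (m z y)"
  using tp unfolding transposed_poisson_structure_def bilinear_product_iff by blast+

lemma lookup_tp_basis:
  assumes "\<not> (g a = 0 \<and> h a + 2 = 0 \<and> g c = 0 \<and> h c + 1 = 0)"
  shows "Poly_Mapping.lookup (m x (block_basis a)) c =
    (if c = a then Poly_Mapping.lookup (m x (block_basis 0)) 0 else 0)"
  by (rule half_derivation_lookup[of "m x", OF tp_simps(1,3,7) assms])

text \<open>This coordinate is the scalar by which u_a acts in degree 0. For a suitable
  \<open>b \<noteq> a\<close> it is the u_b-coefficient of u_a u_b, but in u_b u_a the same
  coefficient is off-diagonal and vanishes.\<close>

lemma tp_basis_zero: "Poly_Mapping.lookup (m (block_basis a) (block_basis 0)) 0 = 0"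
proof -
  \<comment> \<open>\<open>b'\<close> and \<open>b' + b'\<close> are distinct with non-zero
    \<open>g\<close>, so at least one of them differs from \<open>a\<close>.\<close>
  obtain b' where b': "g b' \<noteq> 0" using g_nonzero by blast
  then have "b' + b' \<noteq> b'" "g (b' + b') \<noteq> 0" by (auto simp: additive_simps)
  then obtain b where b: "g b \<noteq> 0" "b \<noteq> a" using b' by metis
  have "Poly_Mapping.lookup (m (block_basis a) (block_basis 0)) 0 =
      Poly_Mapping.lookup (m (block_basis a) (block_basis b)) b"
    using b lookup_tp_basis[of b b "block_basis a"] by simp
  also have "\<dots> = Poly_Mapping.lookup (m (block_basis b) (block_basis a)) b"
    by (subst tp_simps(5)) simp
  also have "\<dots> = 0"
    using b lookup_tp_basis[of a b "block_basis b"] by simp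
  finally show ?thesis .
qed

lemma tp_basis_eq_0:
  assumes "\<not> (g a = 0 \<and> h a + 2 = 0)"
  shows "m x (block_basis a) = 0"
proof (induction x rule: block_basis_induct)
  case (1 b)
  show ?case
    using assms by (intro poly_mapping_eqI) (auto simp: lookup_tp_basis tp_basis_zero)
qed (simp_all add: tp_simps(2,4))

lemma tp_derived_eq_0:
  assumes "x \<in> derived_algebra block_scale br"
  shows "m y x = 0"
proof -
  have "m y 0 = 0" using tp_simps(1)[of y 0 0] by simp
  then have "block.subspace {x. m y x = 0}" by (simp add: block.subspace_def tp_simps(1,3))
  then have "derived_algebra block_scale br \<subseteq> {x. m y x = 0}"
    unfolding derived_algebra_eq by (intro block.span_minimal) (auto simp: tp_basis_eq_0)
  then show ?thesis using assms by blast
qed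

text \<open>The exceptional pairs of \<open>lookup_tp_basis\<close> are ruled out here by the target
  \<open>c\<close>, whereas \<open>tp_basis_eq_0\<close> rules them out by the source
  \<open>a\<close>.\<close>

lemma tp_in_center: "m x y \<in> lie_center br"
proof -
  have "m (block_basis a) (block_basis b) \<in> lie_center br" for a b
    unfolding lie_center_eq span_block_basis by (simp add: lookup_tp_basis tp_basis_zero)
  moreover have "block.subspace (lie_center br)"
    unfolding lie_center_eq by (rule block.subspace_span)
  ultimately have "m (block_basis a) y \<in> lie_center br" for a
    by (induction y rule: block_basis_induct)
      (auto simp: tp_simps(1,3) block.subspace_add block.subspace_scale)
  then show ?thesis
    using \<open>block.subspace (lie_center br)\<close>
    by (induction x rule: block_basis_induct)
      (auto simp: tp_simps(2,4) block.subspace_add block.subspace_scale)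
qed

end

section \<open>Transposed Poisson structures as extensions by zero\<close>

lemma complementary_subspaces_block:
  "complementary_subspaces block_scale
     (block.span {block_basis a | a. g a = 0 \<and> h a + 2 = 0}) (derived_algebra block_scale br)"
  (is "complementary_subspaces _ (block.span ?B) _")
proof -
  let ?C = "{block_basis a :: 'a \<Rightarrow>\<^sub>0 'k | a. \<not> (g a = 0 \<and> h a + 2 = 0)}"
  have "block.span ?B \<inter> block.span ?C = {0}"
    unfolding span_block_basis
    by (auto intro!: poly_mapping_eqI)
      (metis (lifting))
  moreover have "\<exists>v\<in>block.span ?B. \<exists>d\<in>block.span ?C. x = v + d" for x
  proof -
    have "?B \<union> ?C = {block_basis a :: 'a \<Rightarrow>\<^sub>0 'k | a. True}" by blast
    then have "x \<in> block.span (?B \<union> ?C)" by (simp only: span_block_basis) simp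
    then show ?thesis unfolding block.span_Un by blast
  qed
  ultimately show ?thesis
    by (simp add: complementary_subspaces_def derived_algebra_eq block.subspace_span)
qed

text \<open>Both sides of the compatibility identity vanish: brackets have zero component in
  \<open>V\<close>, and all products are central.\<close>

lemma extension_by_zero_transposed_poisson:
  assumes V: "complementary_subspaces block_scale V (derived_algebra block_scale br)"
    and s: "bilinear_commutative_on block_scale V (lie_center br) s"
    and assoc: "associative_by_extension V (derived_algebra block_scale br) s"
  shows "transposed_poisson_structure block_scale br
    (extension_by_zero V (derived_algebra block_scale br) s)"
proof -
  let ?D = "derived_algebra block_scale br"
  let ?e = "extension_by_zero V ?D s" and ?c = "component_along V ?D"
  have V': "block.subspace V" and D: "block.subspace ?D"
    and split: "\<And>x. \<exists>v\<in>V. \<exists>d\<in>?D. x = v + d"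
    using V by (auto simp: complementary_subspaces_def)
  note ca = component_along_add[OF vector_space_block_scale V]
  have c_in: "?c x \<in> V" for x using split[of x] ca by fastforce
  have c_add: "?c (x + y) = ?c x + ?c y" for x y
  proof -
    obtain v d v' d' where *: "v \<in> V" "d \<in> ?D" "x = v + d" "v' \<in> V" "d' \<in> ?D" "y = v' + d'"
      using split[of x] split[of y] by blast
    have "x + y = (v + v') + (d + d')" using * by (simp add: ac_simps)
    also have "?c \<dots> = v + v'" using * by (intro ca block.subspace_add V' D)
    finally show ?thesis using * by (simp add: ca)
  qed
  have c_scale: "?c (block_scale k x) = block_scale k (?c x)" for k x
  proof -
    obtain v d where *: "v \<in> V" "d \<in> ?D" "x = v + d" using split[of x] by blast
    have "?c (block_scale k v + block_scale k d) = block_scale k v"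
      using * by (intro ca block.subspace_scale V' D)
    then show ?thesis using * by (simp add: ca block.scale_right_distrib)
  qed
  have c_D: "?c x = 0" if "x \<in> ?D" for x
    using ca[of 0 x] that V' by (simp add: block.subspace_0)
  have s_Z: "s x y \<in> lie_center br" and s_add: "s (x + y) z = s x z + s y z"
    "s z (x + y) = s z x + s z y" and s_scale: "s (block_scale k x) y = block_scale k (s x y)"
    "s x (block_scale k y) = block_scale k (s x y)" and s_comm: "s x y = s y x"
    if "x \<in> V" "y \<in> V" "z \<in> V" for x y z k
    using s that unfolding bilinear_commutative_on_def by blast+
  have "bilinear_product block_scale ?e"
    unfolding bilinear_product_iff extension_by_zero_def
    by (auto simp: c_add c_scale s_add(1)[OF c_in c_in c_in] s_add(2)[OF c_in c_in c_in]
        s_scale(1)[OF c_in c_in c_in] s_scale(2)[OF c_in c_in c_in])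
  moreover have "?e x y = ?e y x" for x y
    unfolding extension_by_zero_def by (rule s_comm[OF c_in c_in c_in[of 0]])
  moreover have "?e (?e x y) z = ?e x (?e y z)" for x y z
    using assoc unfolding associative_by_extension_def by blast
  moreover have "block_scale 2 (?e z (br x y)) = br (?e z x) y + br x (?e z y)" for x y z
  proof -
    have "br x y \<in> ?D" unfolding derived_algebra_def by (intro block.span_base) blast
    \<comment> \<open>Writing 0 as a scalar multiple lets homogeneity of \<open>s\<close> on
      \<open>V\<close> give \<open>s v 0 = 0\<close>.\<close>
    then have "?e z (br x y) = s (?c z) (block_scale 0 0)" by (simp add: extension_by_zero_def c_D)
    also have "\<dots> = 0"
      by (subst s_scale(2)[OF c_in _ c_in[of 0]]) (auto simp: block.subspace_0 V')
    finally have "?e z (br x y) = 0" .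
    moreover have "br (?e z x) y = 0" "br (?e z y) x = 0"
      using s_Z[OF c_in c_in c_in[of 0]] by (simp_all add: extension_by_zero_def lie_center_def)
    ultimately show ?thesis by (simp add: br_swap[of x])
  qed
  ultimately show ?thesis unfolding transposed_poisson_structure_def by blast
qed

text \<open>The structure \<open>m\<close> serves as its own product on \<open>V\<close>: the
  derived algebra annihilates everything under \<open>m\<close>, so only the components in
  \<open>V\<close> contribute.\<close>

lemma transposed_poisson_extension_by_zero:
  assumes V: "complementary_subspaces block_scale V (derived_algebra block_scale br)"
    and tp: "transposed_poisson_structure block_scale br m"
  shows "extension_by_zero V (derived_algebra block_scale br) m = m"
    and "bilinear_commutative_on block_scale V (lie_center br) m"
    and "associative_by_extension V (derived_algebra block_scale br) m"
proof -
  let ?D = "derived_algebra block_scale br"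
  note m = tp_simps[OF tp]
  show e: "extension_by_zero V ?D m = m"
  proof (intro ext)
    fix x y
    obtain v d v' d' where *: "v \<in> V" "d \<in> ?D" "x = v + d" "v' \<in> V" "d' \<in> ?D" "y = v' + d'"
      using V unfolding complementary_subspaces_def by metis
    have "m d z = 0" for z using tp_derived_eq_0[OF tp *(2), of z] m(5)[of d z] by simp
    then show "extension_by_zero V ?D m x y = m x y"
      using * tp_derived_eq_0[OF tp *(5)]
      by (simp add: extension_by_zero_add[OF vector_space_block_scale V] m(1,2))
  qed
  show "bilinear_commutative_on block_scale V (lie_center br) m"
    unfolding bilinear_commutative_on_def
    by (intro conjI ballI allI) (rule m tp_in_center[OF tp])+
  show "associative_by_extension V ?D m"
    unfolding associative_by_extension_def e by (intro allI) (rule m(6))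
qed

end


theorem theorem29:
  fixes g h :: "'a::ab_group_add \<Rightarrow> 'k::field_char_0"
    and f :: "'a \<Rightarrow> 'a \<Rightarrow> 'k"
  assumes nontrivial: "\<exists>a::'a. a \<noteq> 0"
    and g_additive: "additive g"
    and g_nonzero: "\<exists>a. g a \<noteq> 0"
    and f_antisym: "antisymmetric f"
    and f_biadd: "biadditive f"
    and f_nondeg: "nondegenerate f"
    and h_additive: "additive h"
    and f_gh: "\<forall>a b. f a b = g a * h b - g b * h a"
  shows
    "let br = block_bracket g f;
         V = module.span block_scale {block_basis a | a. g a = 0 \<and> h a + 2 = 0};
         D = derived_algebra block_scale br;
         Z = lie_center br
     in (if \<forall>a. (g a, h a) \<noteq> (0, -1)
         then \<forall>m. transposed_poisson_structure block_scale br m \<longrightarrow> trivial_product m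
         else complementary_subspaces block_scale V D \<and>
              Z = module.span block_scale {block_basis a | a. g a = 0 \<and> h a + 1 = 0} \<and>
              {m. transposed_poisson_structure block_scale br m} =
                {extension_by_zero V D s | s.
                   bilinear_commutative_on block_scale V Z s \<and> associative_by_extension V D s})"
proof -
  interpret block_lie g h f
    by (rule block_lie.intro[OF g_additive g_nonzero f_nondeg h_additive f_gh[rule_format]])
  let ?V = "block.span {block_basis a :: 'a \<Rightarrow>\<^sub>0 'k | a. g a = 0 \<and> h a + 2 = 0}"
  have "trivial_product m"
    if "\<forall>a. (g a, h a) \<noteq> (0, -1)" "transposed_poisson_structure block_scale br m" for m
  proof -
    \<comment> \<open>With no central basis vector the center is zero, and it contains every
      product.\<close>
    have "lie_center br = {0}"
      unfolding lie_center_eq span_block_basis using that(1)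
      by (auto intro!: poly_mapping_eqI simp: eq_neg_iff_add_eq_0)
    then show ?thesis using tp_in_center[OF that(2)] by (auto simp: trivial_product_def)
  qed
  moreover have "{m. transposed_poisson_structure block_scale br m} =
      {extension_by_zero ?V (derived_algebra block_scale br) s | s.
        bilinear_commutative_on block_scale ?V (lie_center br) s \<and>
        associative_by_extension ?V (derived_algebra block_scale br) s}"
    (is "?L = ?R")
  proof
    show "?L \<subseteq> ?R"
    proof
      fix m assume "m \<in> ?L"
      then have "transposed_poisson_structure block_scale br m" by simp
      note ext = transposed_poisson_extension_by_zero[OF complementary_subspaces_block this]
      show "m \<in> ?R" using ext(1)[symmetric] ext(2,3) by blast
    qed
    show "?R \<subseteq> ?L"
      using extension_by_zero_transposed_poisson[OF complementary_subspaces_block] by blast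
  qed
  ultimately show ?thesis
    using complementary_subspaces_block lie_center_eq by (simp add: Let_def)
qed

end
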